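(* Let $x$ be an indeterminate. For integers $s\ge r\ge 0$ let $$k_{r,s}(x) = \binom{x-r}{s-r}\binom{2r}{r}\binom{r+s}{r}^{-1}.$$ Then for all integers $p,q\geq 0$, $$\binom{x}{p+q} = k_{0,p}(x)k_{0,q}(x) + \sum_{i=1}^{\max(p,q)}\lambda_{i+1}(x)\,k_{i,p}(x)\,k_{i,q}(x) = \binom{x}{p}\binom{x}{q} + \sum_{i=1}^{\max(p,q)} \frac{(-1)^i\binom{x-i}{p-i}\binom{x-i}{q-i}\binom{x+i}{i}\binom{x}{i}\binom{2i}{i}^2}{2\cdot\binom{p+i}{i}\binom{q+i}{i}\binom{2i-1}{i-1}^2}.$$
   Context: $\binom{y}{k} = y(y-1)\cdots(y-k+1)/k!$ for integers $k\ge 0$ and $\binom{y}{k}=0$ for integers $k<0$; accordingly $k_{r,s}(x)=0$ when $r>s$. For integers $h\ge 2$, $$\lambda_h(x) := \prod_{i=2}^{h}\mathrm{ab}_{x,i},\qquad \mathrm{ab}_{x,2} := -\tfrac12 x(x+1),\qquad \mathrm{ab}_{x,i} := -\frac{1}{4(2i-3)^2}(x-i+2)(x+i-1)\ \ (i\ge 3),$$ equivalently $$\lambda_h(x) = \frac{(-1)^{h-1}}{2}\binom{x+h-1}{h-1}\binom{x}{h-1}\binom{2h-3}{h-2}^{-2}.$$ *)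

theory Defs
  imports Complex_Main "HOL-Computational_Algebra.Polynomial"
begin

text \<open>The indeterminate \<open>x\<close>, as an element of the polynomial ring \<open>\<rat>[x]\<close>.\<close>

abbreviation indet :: "rat poly" where
  "indet \<equiv> [:0, 1:]"

text \<open>Binomial coefficients with polynomial upper entry; \<open>gchoose\<close> cannot be used since it is
  restricted to fields. The lower entry is an integer because negative values occur and have to
  give \<open>0\<close>, whereas truncated subtraction of naturals would lead to \<open>1\<close>.\<close>

definition binom :: "rat poly \<Rightarrow> int \<Rightarrow> rat poly" where
  "binom y k = (if k < 0 then 0 else smult (1 / fact (nat k)) (\<Prod>i<nat k. y - of_nat i))"

lemma poly_binom: "poly (binom y (int k)) c = poly y c gchoose k"
  by (simp add: binom_def gbinomial_prod_rev atLeast0LessThan poly_prod)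

definition kpoly :: "nat \<Rightarrow> nat \<Rightarrow> rat poly" where
  "kpoly r s =
     smult (of_nat ((2 * r) choose r) * inverse (of_nat ((r + s) choose r)))
       (binom (indet - of_nat r) (int s - int r))"

text \<open>Only the values at \<open>i \<ge> 2\<close> are meaningful.\<close>

definition ab :: "nat \<Rightarrow> rat poly" where
  "ab i =
     (if i = 2 then smult (- 1 / 2) (indet * (indet + 1))
      else smult (- 1 / (4 * (2 * of_nat i - 3)\<^sup>2))
             ((indet - of_nat i + 2) * (indet + of_nat i - 1)))"

definition lam :: "nat \<Rightarrow> rat poly" where
  "lam h = (\<Prod>i = 2..h. ab i)"

end

theory Submission
  imports Defs
begin

text \<open>
  Both sides are polynomials in \<open>x\<close>, so \<open>x\<close> may be replaced by a number. Put
  \<open>A(p, i) = binom(x - i, p - i) / binom(p + i, i)\<close> and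
  \<open>t(p, q, i) = (-1)^i binom(x + i, i) binom(x, i) A(p, i) A(q, i)\<close>. The powers of the central
  binomial coefficient in \<open>\<lambda>_{i+1}\<close>, \<open>k_{i,p}\<close> and \<open>k_{i,q}\<close> cancel (lemma \<open>poly_lam\<close>), so that both
  sums of the theorem become \<open>S(p, q) = t(p, q, 0) + 2 \<Sum>_{i \<ge> 1} t(p, q, i)\<close>. The weight \<open>2\<close>
  reflects that this is naturally a sum over all integers \<open>i\<close> of a summand even in \<open>i\<close>.

  The claim \<open>S(p, q) = binom(x, p + q)\<close> says in particular that \<open>S(p, q)\<close> depends on \<open>p + q\<close> only,
  and conversely this suffices: if \<open>S(p + 1, q) = S(p, q + 1)\<close>, then
  \<open>S(p, q) = S(0, p + q) = t(0, p + q, 0) = binom(x, p + q)\<close>. The exchange of a unit between \<open>p\<close>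
  and \<open>q\<close> is a telescoping argument. With \<open>a = p + 1\<close> and \<open>b = q + 1\<close>,
  \<open>2 (t(p + 1, q, i) - t(p, q + 1, i))\<close> equals
  \<open>(b - a) t(p, q, i) ((x + 1 + i) / ((a + i)(b + i)) + (x + 1 - i) / ((a - i)(b - i)))\<close>
  (lemma \<open>summand_exchange\<close>); the ratio of consecutive summands (lemma \<open>summand_Suc\<close>) shows that the
  first fraction at \<open>i\<close> cancels the second one at \<open>i + 1\<close>. At \<open>i = 0\<close> the two fractions coincide,
  and the weight \<open>1\<close> keeps one of them. If \<open>p < q\<close>, which suffices because \<open>S\<close> is symmetric in \<open>p\<close>
  and \<open>q\<close>, then what remains at the upper end \<open>i = p\<close> is cancelled by the only summand that \<open>S(p + 1, q)\<close> has beyond the range of \<open>S(p, q + 1)\<close>.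
\<close>

section \<open>Recurrences for the binomial factors\<close>

text \<open>The numbers \<open>A(p, i)\<close>, that is \<open>k_{i,p}(x)\<close> without its factor \<open>binom(2 i, i)\<close>. The
  case distinction gives the value \<open>0\<close> for \<open>i > p\<close>, where truncated subtraction would give the
  binomial coefficient the value \<open>1\<close>.\<close>

definition kfac :: "'a::field_char_0 \<Rightarrow> nat \<Rightarrow> nat \<Rightarrow> 'a" where
  "kfac x p i = (if i \<le> p then ((x - of_nat i) gchoose (p - i)) / of_nat ((p + i) choose i) else 0)"

text \<open>The factors are not divided out, as \<open>p + 1 - i\<close> and \<open>p + 1 + i\<close> become the denominators
  \<open>a - i\<close> and \<open>a + i\<close> of the telescoping identity.\<close>

lemma kfac_Suc_upper:
  fixes x :: "'a::field_char_0"
  assumes "i \<le> p"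
  shows "kfac x (Suc p) i * ((of_nat p + 1 - of_nat i) * (of_nat p + 1 + of_nat i))
       = kfac x p i * ((x - of_nat p) * (of_nat p + 1))"
proof -
  obtain d where d: "p = i + d" using assms le_Suc_ex by blast
  define B where "B = (of_nat ((p + i) choose i) :: 'a)"
  define B' where "B' = (of_nat ((Suc p + i) choose i) :: 'a)"
  define g where "g = ((x - of_nat i) gchoose d)"
  define g' where "g' = ((x - of_nat i) gchoose Suc d)"
  have "Suc p * ((Suc p + i) choose i) = (Suc p + i) * ((p + i) choose i)"
    using binomial_absorb_comp[of "Suc p + i" i] by simp
  hence "of_nat (Suc p) * B' = of_nat (Suc p + i) * B"
    unfolding B_def B'_def of_nat_mult[symmetric] by (simp only:)
  hence B: "(of_nat p + 1) * B' = (of_nat p + 1 + of_nat i) * B"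
    by (simp add: algebra_simps)
  have g: "g' * (of_nat d + 1) = g * (x - of_nat p)"
    using gbinomial_mult_1[of "x - of_nat i" d] unfolding g_def g'_def d
    by (simp add: algebra_simps)
  have nz: "B \<noteq> 0" "B' \<noteq> 0" by (simp_all add: B_def B'_def)
  have k: "kfac x (Suc p) i = g' / B'" "kfac x p i = g / B"
    by (simp_all add: kfac_def d g_def g'_def B_def B'_def Suc_diff_le)
  have "g' * (of_nat d + 1) * ((of_nat p + 1 + of_nat i) * B)
      = g * (x - of_nat p) * ((of_nat p + 1) * B')"
    using B g by simp
  thus ?thesis unfolding k using nz by (simp add: d field_simps)
qed

text \<open>The factor \<open>x - i\<close> stays on the left, since it may vanish.\<close>

lemma kfac_Suc_lower:
  fixes x :: "'a::field_char_0"
  assumes "i < p"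
  shows "kfac x p (Suc i) * ((x - of_nat i) * (of_nat p + 1 + of_nat i))
       = kfac x p i * ((of_nat p - of_nat i) * (of_nat i + 1))"
proof -
  obtain d where d: "p = Suc (i + d)" using assms less_imp_Suc_add by blast
  define B where "B = (of_nat ((p + i) choose i) :: 'a)"
  define B' where "B' = (of_nat ((p + Suc i) choose Suc i) :: 'a)"
  define g where "g = ((x - of_nat i) gchoose Suc d)"
  define g' where "g' = ((x - of_nat (Suc i)) gchoose d)"
  have "Suc i * ((p + Suc i) choose Suc i) = Suc (p + i) * ((p + i) choose i)"
    using Suc_times_binomial[of i "p + i"] by simp
  hence "of_nat (Suc i) * B' = of_nat (Suc (p + i)) * B"
    unfolding B_def B'_def of_nat_mult[symmetric] by (simp only:)
  hence B: "(of_nat i + 1) * B' = (of_nat p + 1 + of_nat i) * B"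
    by (simp add: algebra_simps)
  have g: "g * (of_nat d + 1) = (x - of_nat i) * g'"
    using gbinomial_absorption[of d "x - of_nat i"] unfolding g_def g'_def
    by (simp add: algebra_simps)
  have nz: "B \<noteq> 0" "B' \<noteq> 0" by (simp_all add: B_def B'_def del: binomial_Suc_Suc)
  have k: "kfac x p (Suc i) = g' / B'" "kfac x p i = g / B"
    by (simp_all add: kfac_def d g_def g'_def B_def B'_def Suc_diff_le)
  have "(x - of_nat i) * g' * ((of_nat p + 1 + of_nat i) * B)
      = g * (of_nat d + 1) * ((of_nat i + 1) * B')"
    using B g by simp
  thus ?thesis unfolding k using nz by (simp add: d field_simps)
qed

lemma gbinomial_Suc_mult:
  fixes x :: "'a::field_char_0"
  shows "(x gchoose Suc i) * (of_nat i + 1) = (x gchoose i) * (x - of_nat i)"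
  using gbinomial_mult_1[of x i] by (simp add: algebra_simps)

lemma gbinomial_shift_Suc_mult:
  fixes x :: "'a::field_char_0"
  shows "((x + of_nat (Suc i)) gchoose Suc i) * (of_nat i + 1)
       = ((x + of_nat i) gchoose i) * (x + 1 + of_nat i)"
  using gbinomial_absorption[of i "x + of_nat (Suc i)"] by (simp add: algebra_simps)

lemma of_nat_plus_1_neq_0: "of_nat i + 1 \<noteq> (0 :: 'a::field_char_0)"
  by (metis add.commute of_nat_Suc of_nat_neq_0)

text \<open>This recurrence matches the constants \<open>4 (2 i - 3)^2\<close> in \<open>ab\<close> to central binomial
  coefficients, and it evaluates the last summand \<open>i = p + 1\<close>, where \<open>A(p, p)\<close> is the reciprocal
  of a central binomial coefficient.\<close>

lemma central_binomial_Suc: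
  "(of_nat n + 1) * of_nat ((2 * Suc n) choose Suc n)
     = 2 * (2 * of_nat n + 1) * (of_nat ((2 * n) choose n) :: 'a::field_char_0)"
proof -
  define u v w where "u = (2 * Suc n) choose Suc n" and "v = Suc (2 * n) choose n"
    and "w = (2 * n) choose n"
  have "Suc n * u = Suc n * (2 * v)"
    using Suc_times_binomial[of n "Suc (2 * n)"] by (simp add: u_def v_def del: binomial_Suc_Suc)
  hence u: "u = 2 * v" by (simp only: mult_cancel1) simp
  have v: "Suc n * v = Suc (2 * n) * w"
    using binomial_absorb_comp[of "Suc (2 * n)" n] by (simp add: v_def w_def Suc_diff_le)
  have "Suc n * u = 2 * (Suc (2 * n) * w)"
    unfolding u v[symmetric] by simp
  hence "of_nat (Suc n * u) = (of_nat (2 * (Suc (2 * n) * w)) :: 'a)" by (simp only:)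
  thus ?thesis unfolding u_def w_def by (simp add: algebra_simps del: binomial_Suc_Suc)
qed

text \<open>A summand contains two factors \<open>A\<close> and two binomial coefficients in \<open>x\<close>, and is paired
  off as \<open>binom(x, i) A(p, i)\<close> and \<open>binom(x + i, i) A(q, i)\<close>. In the first pair the factor \<open>x - i\<close> of
  \<open>kfac_Suc_lower\<close> is absorbed by \<open>binom(x, i + 1)\<close>. This is why the ratio of consecutive
  summands holds for every \<open>x\<close>, including the natural numbers.\<close>

lemma gbinomial_kfac_step:
  fixes x :: "'a::field_char_0"
  assumes "i < p"
  shows "(x gchoose Suc i) * kfac x p (Suc i) * (of_nat p + 1 + of_nat i)
       = (x gchoose i) * kfac x p i * (of_nat p - of_nat i)"
proof -
  define j where "j = (of_nat i + 1 :: 'a)"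
  have j: "j \<noteq> 0" by (simp add: j_def of_nat_plus_1_neq_0)
  have c: "(x gchoose Suc i) * j = (x gchoose i) * (x - of_nat i)"
    unfolding j_def by (rule gbinomial_Suc_mult)
  have "(x gchoose Suc i) * kfac x p (Suc i) * (of_nat p + 1 + of_nat i) * j
      = (x gchoose i) * kfac x p i * (of_nat p - of_nat i) * j"
    using c kfac_Suc_lower[OF assms, of x, folded j_def] by algebra
  thus ?thesis using j by simp
qed

lemma gbinomial_shift_kfac_step:
  fixes x :: "'a::field_char_0"
  assumes "i < q"
  shows "((x + of_nat (Suc i)) gchoose Suc i) * kfac x q (Suc i)
           * ((x - of_nat i) * (of_nat q + 1 + of_nat i))
       = ((x + of_nat i) gchoose i) * kfac x q i
           * ((x + 1 + of_nat i) * (of_nat q - of_nat i))"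
proof -
  define j where "j = (of_nat i + 1 :: 'a)"
  have j: "j \<noteq> 0" by (simp add: j_def of_nat_plus_1_neq_0)
  define e e' where "e = (x + of_nat i) gchoose i" and "e' = (x + of_nat (Suc i)) gchoose Suc i"
  have e: "e' * j = e * (x + 1 + of_nat i)"
    unfolding e_def e'_def j_def by (rule gbinomial_shift_Suc_mult)
  have "e' * kfac x q (Suc i) * ((x - of_nat i) * (of_nat q + 1 + of_nat i)) * j
      = e * kfac x q i * ((x + 1 + of_nat i) * (of_nat q - of_nat i)) * j"
    using e kfac_Suc_lower[OF assms, of x, folded j_def] by algebra
  thus ?thesis using j by (simp add: e_def e'_def)
qed

section \<open>The summand and its telescoping difference\<close>

definition summand :: "'a::field_char_0 \<Rightarrow> nat \<Rightarrow> nat \<Rightarrow> nat \<Rightarrow> 'a" where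
  "summand x p q i = (- 1) ^ i * ((x + of_nat i) gchoose i) * (x gchoose i) * kfac x p i * kfac x q i"

lemma summand_commute: "summand x p q i = summand x q p i"
  by (simp add: summand_def)

lemma summand_eq_0: "p < i \<Longrightarrow> summand x p q i = 0"
  by (simp add: summand_def kfac_def)

lemma summand_Suc:
  fixes x :: "'a::field_char_0"
  assumes "i < p" "i < q"
  shows "summand x p q (Suc i) * ((x - of_nat i) * ((of_nat p + 1 + of_nat i) * (of_nat q + 1 + of_nat i)))
       = - (summand x p q i * ((x + 1 + of_nat i) * ((of_nat p - of_nat i) * (of_nat q - of_nat i))))"
    (is "?L = ?R")
proof -
  have "?L = - ((- 1) ^ i * (((x gchoose Suc i) * kfac x p (Suc i) * (of_nat p + 1 + of_nat i))
      * (((x + of_nat (Suc i)) gchoose Suc i) * kfac x q (Suc i)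
           * ((x - of_nat i) * (of_nat q + 1 + of_nat i)))))"
    unfolding summand_def power_Suc by (simp only: mult_ac mult_minus_left mult_1_left mult_minus_right)
  also have "\<dots> = ?R"
    unfolding gbinomial_kfac_step[OF assms(1)] gbinomial_shift_kfac_step[OF assms(2)]
    unfolding summand_def by (simp only: mult_ac)
  finally show ?thesis .
qed

text \<open>After passing from \<open>p + 1\<close> to \<open>p\<close> and from \<open>q + 1\<close> to \<open>q\<close>, the left-hand side is
  \<open>t(p, q, i)\<close> times a difference of two fractions with denominators \<open>a^2 - i^2\<close> and \<open>b^2 - i^2\<close>.
  The right-hand side is its partial fraction decomposition adapted to telescoping: replacing
  \<open>i\<close> by \<open>-i\<close> swaps the two fractions.\<close>

lemma summand_exchange:
  fixes x :: "'a::field_char_0"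
  assumes "i \<le> p" "i \<le> q"
  defines "a \<equiv> of_nat p + 1 :: 'a" and "b \<equiv> of_nat q + 1 :: 'a" and "j \<equiv> of_nat i :: 'a"
  shows "2 * (summand x (Suc p) q i - summand x p (Suc q) i)
       = (b - a) * summand x p q i
           * ((x + 1 + j) / ((a + j) * (b + j)) + (x + 1 - j) / ((a - j) * (b - j)))"
proof -
  have "a + j = of_nat (p + 1 + i)" "b + j = of_nat (q + 1 + i)"
       "a - j = of_nat (p + 1 - i)" "b - j = of_nat (q + 1 - i)"
    using assms(1,2) by (simp_all add: a_def b_def j_def of_nat_diff)
  moreover have "p + 1 - i \<noteq> 0" "q + 1 - i \<noteq> 0"
    using assms(1,2) by auto
  ultimately have nz: "a + j \<noteq> 0" "b + j \<noteq> 0" "a - j \<noteq> 0" "b - j \<noteq> 0"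
    by (simp_all only: of_nat_eq_0_iff) auto
  have p: "kfac x (Suc p) i = kfac x p i * ((x + 1 - a) * a) / ((a - j) * (a + j))"
    using kfac_Suc_upper[OF assms(1), of x] nz by (simp add: a_def j_def eq_divide_eq)
  have q: "kfac x (Suc q) i = kfac x q i * ((x + 1 - b) * b) / ((b - j) * (b + j))"
    using kfac_Suc_upper[OF assms(2), of x] nz by (simp add: b_def j_def eq_divide_eq)
  define s where "s = summand x p q i"
  have s: "summand x (Suc p) q i = s * ((x + 1 - a) * a) / ((a - j) * (a + j))"
          "summand x p (Suc q) i = s * ((x + 1 - b) * b) / ((b - j) * (b + j))"
    by (simp_all add: s_def summand_def p q)
  have "2 * (((x + 1 - a) * a) / ((a - j) * (a + j)) - ((x + 1 - b) * b) / ((b - j) * (b + j)))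
      = (b - a) * ((x + 1 + j) / ((a + j) * (b + j)) + (x + 1 - j) / ((a - j) * (b - j)))"
    using nz by (simp add: divide_simps) algebra
  moreover have "2 * (summand x (Suc p) q i - summand x p (Suc q) i)
      = s * (2 * (((x + 1 - a) * a) / ((a - j) * (a + j)) - ((x + 1 - b) * b) / ((b - j) * (b + j))))"
    by (simp only: s right_diff_distrib times_divide_eq_right mult_ac)
  ultimately show ?thesis
    by (simp only: s_def mult_ac)
qed

definition weighted_sum :: "'a::field_char_0 \<Rightarrow> nat \<Rightarrow> nat \<Rightarrow> nat \<Rightarrow> 'a" where
  "weighted_sum x p q n = summand x p q 0 + 2 * (\<Sum>i = 1..n. summand x p q i)"

lemma weighted_sum_Suc: "weighted_sum x p q (Suc n) = weighted_sum x p q n + 2 * summand x p q (Suc n)"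
  by (simp add: weighted_sum_def algebra_simps)

text \<open>The upper end of the telescoping sum is the first fraction of \<open>summand_exchange\<close> at
  \<open>i = n\<close>. The bound on \<open>n\<close> keeps the denominators \<open>a - i\<close> and \<open>b - i\<close> nonzero.\<close>

lemma weighted_sum_exchange_partial:
  fixes x :: "'a::field_char_0"
  assumes "n \<le> p" "n \<le> q"
  shows "weighted_sum x (Suc p) q n - weighted_sum x p (Suc q) n
       = (of_nat q - of_nat p) * summand x p q n * (x + 1 + of_nat n)
           / ((of_nat p + 1 + of_nat n) * (of_nat q + 1 + of_nat n))"
  using assms
proof (induction n)
  case 0
  \<comment> \<open>The two fractions agree here, so halving leaves exactly one of them.\<close>
  have "2 * (summand x (Suc p) q 0 - summand x p (Suc q) 0)
      = 2 * ((of_nat q - of_nat p) * summand x p q 0 * (x + 1) / ((of_nat p + 1) * (of_nat q + 1)))"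
    using summand_exchange[of 0 p q x] by (simp add: mult.assoc)
  hence "summand x (Suc p) q 0 - summand x p (Suc q) 0
      = (of_nat q - of_nat p) * summand x p q 0 * (x + 1) / ((of_nat p + 1) * (of_nat q + 1))"
    unfolding mult_cancel_left by simp
  thus ?case by (simp add: weighted_sum_def)
next
  case (Suc n)
  define a b j where "a = (of_nat p + 1 :: 'a)" and "b = (of_nat q + 1 :: 'a)" and "j = (of_nat n :: 'a)"
  have n: "n < p" "n < q" using Suc.prems by auto
  have "a + j = of_nat (p + 1 + n)" "b + j = of_nat (q + 1 + n)"
       "a - (j + 1) = of_nat (p - n)" "b - (j + 1) = of_nat (q - n)"
    using n by (simp_all add: a_def b_def j_def of_nat_diff)
  moreover have "p - n \<noteq> 0" "q - n \<noteq> 0" using n by auto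
  ultimately have nz: "a + j \<noteq> 0" "b + j \<noteq> 0" "a - (j + 1) \<noteq> 0" "b - (j + 1) \<noteq> 0"
    by (simp_all only: of_nat_eq_0_iff) auto
  \<comment> \<open>The first fraction at \<open>n\<close> is minus the second fraction at \<open>n + 1\<close>.\<close>
  have flux: "summand x p q n * (x + 1 + j) / ((a + j) * (b + j))
      = - (summand x p q (Suc n) * (x + 1 - (j + 1)) / ((a - (j + 1)) * (b - (j + 1))))"
  proof -
    have "summand x p q (Suc n) * ((x - j) * ((a + j) * (b + j)))
       = - (summand x p q n * ((x + 1 + j) * ((a - (j + 1)) * (b - (j + 1)))))"
      using summand_Suc[OF n, of x] by (simp add: a_def b_def j_def algebra_simps)
    thus ?thesis using nz by (simp add: divide_simps) algebra
  qed
  have "weighted_sum x (Suc p) q (Suc n) - weighted_sum x p (Suc q) (Suc n)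
      = (b - a) * (summand x p q n * (x + 1 + j) / ((a + j) * (b + j)))
        + 2 * (summand x (Suc p) q (Suc n) - summand x p (Suc q) (Suc n))"
    using Suc.IH n by (simp add: weighted_sum_Suc a_def b_def j_def algebra_simps)
  also have "\<dots> = (b - a) * summand x p q (Suc n) * (x + 1 + (j + 1)) / ((a + (j + 1)) * (b + (j + 1)))"
    unfolding flux using summand_exchange[of "Suc n" p q x] Suc.prems
    by (simp add: a_def b_def j_def ring_distribs add_ac)
  finally show ?case by (simp add: a_def b_def j_def add_ac)
qed

section \<open>The sum depends only on \<open>p + q\<close>\<close>

lemma weighted_sum_extend:
  assumes "p \<le> n"
  shows "weighted_sum x p q n = weighted_sum x p q p"
  using assms by (induction n rule: dec_induct) (simp_all add: weighted_sum_Suc summand_eq_0)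

text \<open>The telescoping is available up to \<open>i = p\<close>. The sum on the left has one further summand,
  \<open>i = p + 1\<close>, which is minus the remaining boundary term. In the notation of the proof,
  \<open>P\<close> and \<open>Q\<close> are the two pairs of factors at \<open>i = p\<close>, and \<open>P'\<close> and \<open>Q'\<close> those at \<open>i = p + 1\<close>, with
  upper parameter \<open>p + 1\<close> instead of \<open>p\<close> in \<open>P'\<close>.\<close>

lemma weighted_sum_exchange:
  fixes x :: "'a::field_char_0"
  assumes "p < q"
  shows "weighted_sum x (Suc p) q (Suc p) = weighted_sum x p (Suc q) p"
proof -
  define P P' where "P = (x gchoose p) * kfac x p p"
    and "P' = (x gchoose Suc p) * kfac x (Suc p) (Suc p)"
  define Q Q' where "Q = ((x + of_nat p) gchoose p) * kfac x q p"
    and "Q' = ((x + of_nat (Suc p)) gchoose Suc p) * kfac x q (Suc p)"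
  define d e where "d = (2 * of_nat p + 1 :: 'a)" and "e = (of_nat q + 1 + of_nat p :: 'a)"
  have "d = of_nat (2 * p + 1)" "e = of_nat (q + 1 + p)" by (simp_all add: d_def e_def)
  hence nz: "d \<noteq> 0" "e \<noteq> 0" by (simp_all only: of_nat_eq_0_iff)
  have P: "2 * P' * d = P * (x - of_nat p)"
  proof -
    define j where "j = (of_nat p + 1 :: 'a)"
    have j: "j \<noteq> 0" by (simp add: j_def of_nat_plus_1_neq_0)
    define B B' where "B = (of_nat ((2 * p) choose p) :: 'a)"
      and "B' = (of_nat ((2 * Suc p) choose Suc p) :: 'a)"
    have nzB: "B \<noteq> 0" "B' \<noteq> 0"
      by (simp_all only: B_def B'_def of_nat_eq_0_iff binomial_eq_0_iff) auto
    have B: "j * B' = 2 * d * B"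
      unfolding B_def B'_def j_def d_def by (rule central_binomial_Suc)
    have c: "(x gchoose Suc p) * j = (x gchoose p) * (x - of_nat p)"
      unfolding j_def by (rule gbinomial_Suc_mult)
    have k: "kfac x p p = 1 / B" "kfac x (Suc p) (Suc p) = 1 / B'"
      unfolding kfac_def B_def B'_def mult_2 by simp_all
    have "2 * (x gchoose Suc p) * d * B * j = (x gchoose p) * (x - of_nat p) * B' * j"
      using B c by algebra
    hence "2 * (x gchoose Suc p) * d * B = (x gchoose p) * (x - of_nat p) * B'"
      using j by simp
    thus ?thesis using nzB unfolding P_def P'_def k by (simp add: field_simps)
  qed
  have Q: "Q' * ((x - of_nat p) * e) = Q * ((x + 1 + of_nat p) * (of_nat q - of_nat p))"
    using gbinomial_shift_kfac_step[OF assms, of x] by (simp only: Q_def Q'_def e_def)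
  have s: "summand x p q p = (- 1) ^ p * (P * Q)"
          "summand x (Suc p) q (Suc p) = - ((- 1) ^ p * (P' * Q'))"
    unfolding summand_def P_def P'_def Q_def Q'_def by (simp_all only: power_Suc mult_ac) simp
  have "weighted_sum x (Suc p) q (Suc p) - weighted_sum x p (Suc q) p
      = (weighted_sum x (Suc p) q p - weighted_sum x p (Suc q) p) + 2 * summand x (Suc p) q (Suc p)"
    by (simp add: weighted_sum_Suc)
  also have "\<dots> = (of_nat q - of_nat p) * ((- 1) ^ p * (P * Q)) * (x + 1 + of_nat p) / (d * e)
      - 2 * ((- 1) ^ p * (P' * Q'))"
    unfolding weighted_sum_exchange_partial[OF order.refl less_imp_le[OF assms]] s
    by (simp add: d_def e_def)
  also have "\<dots> = (- 1) ^ p * (P * (Q * ((x + 1 + of_nat p) * (of_nat q - of_nat p))) / (d * e) - 2 * P' * Q')"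
    by (simp add: algebra_simps)
  also have "\<dots> = (- 1) ^ p * (P * (Q' * ((x - of_nat p) * e)) / (d * e) - 2 * P' * Q')"
    unfolding Q ..
  also have "P * (Q' * ((x - of_nat p) * e)) / (d * e) = P * (x - of_nat p) * Q' / d"
    using nz by simp
  also have "\<dots> = 2 * P' * Q'"
    unfolding P[symmetric] using nz by simp
  finally show ?thesis by simp
qed

text \<open>The induction moves units from \<open>p\<close> to \<open>q\<close> and hence preserves \<open>p \<le> q\<close>, so the exchange
  is only applied from a pair \<open>(p + 1, q)\<close> with \<open>p < q\<close>.\<close>

lemma weighted_sum_eq_gbinomial_aux:
  assumes "p \<le> q"
  shows "weighted_sum x p q p = x gchoose (p + q)"
  using assms
proof (induction p arbitrary: q)
  case 0
  show ?case by (simp add: weighted_sum_def summand_def kfac_def)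
next
  case (Suc p)
  thus ?case using weighted_sum_exchange[of p q x] Suc.IH[of "Suc q"] by simp
qed

lemma weighted_sum_eq_gbinomial: "weighted_sum x p q (max p q) = x gchoose (p + q)"
proof (induction p q rule: linorder_wlog)
  case (le p q)
  thus ?case using weighted_sum_extend[of p "max p q" x q] weighted_sum_eq_gbinomial_aux[of p q] by simp
next
  case (sym p q)
  moreover have "weighted_sum x q p (max q p) = weighted_sum x p q (max p q)"
    by (simp add: weighted_sum_def summand_commute max.commute)
  ultimately show ?case by (simp add: add.commute)
qed

section \<open>Evaluating the polynomials\<close>

lemma poly_binom_diff:
  "poly (binom (indet - of_nat i) (int p - int i)) c
     = (if i \<le> p then (c - of_nat i) gchoose (p - i) else 0)"
proof (cases "i \<le> p")
  case True
  hence "int p - int i = int (p - i)" by simp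
  thus ?thesis using True by (simp only: poly_binom) simp
qed (simp add: binom_def)

lemma poly_kpoly: "poly (kpoly i p) c = of_nat ((2 * i) choose i) * kfac c p i"
  by (simp add: kpoly_def poly_binom_diff kfac_def divide_inverse add.commute)

text \<open>The induction step rests on
  \<open>ab_{i+2} = - (x - i) (x + i + 1) / (4 (2 i + 1)^2)\<close>: up to a factor \<open>(i + 1)^2\<close> that occurs in both, the
  numerator is the growth of \<open>binom(x, i) binom(x + i, i)\<close> and the denominator is the growth of the
  squared central binomial coefficient. The induction starts at \<open>i = 1\<close>, because the factor \<open>2\<close>
  comes from the exceptional value of \<open>ab\<close> at \<open>2\<close>, whereas \<open>lam 1\<close> is the empty product.\<close>

lemma poly_lam:
  assumes "i \<ge> 1"
  shows "poly (lam (i + 1)) c * (of_nat ((2 * i) choose i))\<^sup>2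
       = 2 * ((- 1) ^ i * ((c + of_nat i) gchoose i) * (c gchoose i))"
  using assms
proof (induction i rule: nat_induct_at_least)
  case base
  show ?case by (simp add: lam_def ab_def power2_eq_square algebra_simps)
next
  case (Suc i)
  define j where "j = (of_nat i + 1 :: rat)"
  have j: "j \<noteq> 0" by (simp add: j_def of_nat_plus_1_neq_0)
  define B B' where "B = (of_nat ((2 * i) choose i) :: rat)"
    and "B' = (of_nat ((2 * Suc i) choose Suc i) :: rat)"
  define d where "d = (2 * of_nat i + 1 :: rat)"
  have "d = of_nat (2 * i + 1)" by (simp add: d_def)
  hence d: "d \<noteq> 0" by (simp only: of_nat_eq_0_iff)
  have B: "j * B' = 2 * d * B"
    unfolding B_def B'_def j_def d_def by (rule central_binomial_Suc)
  define a a' where "a = c gchoose i" and "a' = c gchoose Suc i"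
  define e e' where "e = (c + of_nat i) gchoose i" and "e' = (c + of_nat (Suc i)) gchoose Suc i"
  have a: "a' * j = a * (c - of_nat i)"
    unfolding a_def a'_def j_def by (rule gbinomial_Suc_mult)
  have e: "e' * j = e * (c + 1 + of_nat i)"
    unfolding e_def e'_def j_def by (rule gbinomial_shift_Suc_mult)
  define l where "l = poly (lam (i + 1)) c"
  have IH: "l * B\<^sup>2 = 2 * ((- 1) ^ i * e * a)"
    using Suc.IH by (simp only: l_def B_def e_def a_def)
  have "lam (i + 2) = lam (i + 1) * ab (i + 2)"
    by (simp add: lam_def)
  moreover have "poly (ab (i + 2)) c = - ((c - of_nat i) * (c + 1 + of_nat i) / (4 * d\<^sup>2))"
  proof -
    have "2 * of_nat (i + 2) - 3 = d" "c - of_nat (i + 2) + 2 = c - of_nat i"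
         "c + of_nat (i + 2) - 1 = c + 1 + of_nat i"
      by (simp_all add: d_def)
    thus ?thesis
      using Suc.hyps by (simp add: ab_def poly_pCons flip: of_nat_add del: of_nat_add)
  qed
  ultimately have l: "poly (lam (i + 2)) c = - (l * ((c - of_nat i) * (c + 1 + of_nat i)) / (4 * d\<^sup>2))"
    by (simp add: l_def)
  have "poly (lam (i + 2)) c * B'\<^sup>2 * j\<^sup>2
      = - (l * ((c - of_nat i) * (c + 1 + of_nat i)) / (4 * d\<^sup>2)) * (j * B')\<^sup>2"
    unfolding l power_mult_distrib by (simp only: mult_ac)
  also have "\<dots> = - (l * B\<^sup>2 * ((c - of_nat i) * (c + 1 + of_nat i)))"
    unfolding B using d by (simp add: power_mult_distrib)
  also have "\<dots> = - (2 * (- 1) ^ i * (a * (c - of_nat i)) * (e * (c + 1 + of_nat i)))"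
    unfolding IH by (simp only: mult_ac)
  also have "\<dots> = 2 * ((- 1) ^ Suc i * e' * a') * j\<^sup>2"
    unfolding a[symmetric] e[symmetric] by (simp add: power2_eq_square)
  finally have "poly (lam (i + 2)) c * B'\<^sup>2 * j\<^sup>2 = 2 * ((- 1) ^ Suc i * e' * a') * j\<^sup>2" .
  moreover have "j\<^sup>2 \<noteq> 0" using j by simp
  ultimately have "poly (lam (i + 2)) c * B'\<^sup>2 = 2 * ((- 1) ^ Suc i * e' * a')"
    by (metis mult_right_cancel)
  thus ?case by (simp only: a'_def e'_def B'_def Suc_eq_plus1 add.assoc one_add_one)
qed

lemma poly_lam_kpoly:
  assumes "i \<ge> 1"
  shows "poly (lam (i + 1) * kpoly i p * kpoly i q) c = 2 * summand c p q i"
proof -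
  have "poly (lam (i + 1) * kpoly i p * kpoly i q) c
      = (poly (lam (i + 1)) c * (of_nat ((2 * i) choose i))\<^sup>2) * (kfac c p i * kfac c q i)"
    by (simp add: poly_kpoly power2_eq_square)
  also have "\<dots> = 2 * summand c p q i"
    unfolding poly_lam[OF assms] summand_def by (simp only: mult_ac)
  finally show ?thesis .
qed

lemma central_binomial_eq_double:
  assumes "i \<ge> 1"
  shows "(2 * i) choose i = 2 * ((2 * i - 1) choose (i - 1))"
proof -
  have "i * ((2 * i) choose i) = i * (2 * ((2 * i - 1) choose (i - 1)))"
    using times_binomial_minus1_eq[of i "2 * i"] assms by simp
  thus ?thesis using assms by simp
qed

text \<open>By \<open>central_binomial_eq_double\<close>, the two squares of binomial coefficients in the
  coefficient have quotient \<open>4\<close>, so the coefficient carries the same weight \<open>2\<close>.\<close>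

lemma poly_explicit_summand:
  assumes "i \<ge> 1"
  shows "poly (smult ((- 1) ^ i * (of_nat ((2 * i) choose i))\<^sup>2
                / (2 * of_nat ((p + i) choose i) * of_nat ((q + i) choose i)
                     * (of_nat ((2 * i - 1) choose (i - 1)))\<^sup>2))
              (binom (indet - of_nat i) (int p - int i)
                 * binom (indet - of_nat i) (int q - int i)
                 * binom (indet + of_nat i) (int i) * binom indet (int i))) c
       = 2 * summand c p q i"
proof -
  define m where "m = (2 * i - 1) choose (i - 1)"
  have m: "m \<noteq> 0" by (simp add: m_def)
  show ?thesis
    unfolding central_binomial_eq_double[OF assms] m_def[symmetric]
    using m by (simp add: poly_binom poly_binom_diff summand_def kfac_def power2_eq_square)
qed

section \<open>The polynomial identity\<close>

lemma poly_eq_by_evaluation: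
  fixes f g :: "'a::{idom, ring_char_0} poly"
  assumes "\<And>c. poly f c = poly g c"
  shows "f = g"
  using assms by (simp add: poly_eq_poly_eq_iff[symmetric] fun_eq_iff)

theorem corollary3p6:
  fixes p q :: nat
  shows
    "binom indet (int (p + q)) =
       kpoly 0 p * kpoly 0 q
       + (\<Sum>i = 1..max p q. lam (i + 1) * kpoly i p * kpoly i q)
     \<and>
     kpoly 0 p * kpoly 0 q
       + (\<Sum>i = 1..max p q. lam (i + 1) * kpoly i p * kpoly i q) =
       binom indet (int p) * binom indet (int q)
       + (\<Sum>i = 1..max p q.
            smult ((- 1) ^ i * (of_nat ((2 * i) choose i))\<^sup>2
                / (2 * of_nat ((p + i) choose i) * of_nat ((q + i) choose i)
                     * (of_nat ((2 * i - 1) choose (i - 1)))\<^sup>2))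
              (binom (indet - of_nat i) (int p - int i)
                 * binom (indet - of_nat i) (int q - int i)
                 * binom (indet + of_nat i) (int i) * binom indet (int i)))"
proof -
  let ?S = "\<Sum>i = 1..max p q. lam (i + 1) * kpoly i p * kpoly i q"
  have 1: "binom indet (int (p + q)) = kpoly 0 p * kpoly 0 q + ?S"
  proof (rule poly_eq_by_evaluation)
    fix c
    have "poly ?S c = (\<Sum>i = 1..max p q. 2 * summand c p q i)"
      unfolding poly_sum by (intro sum.cong refl poly_lam_kpoly) simp
    moreover have "poly (kpoly 0 p * kpoly 0 q) c = summand c p q 0"
      by (simp add: poly_kpoly summand_def)
    moreover have "poly (binom indet (int (p + q))) c = weighted_sum c p q (max p q)"
      by (simp only: poly_binom weighted_sum_eq_gbinomial) simp
    ultimately show "poly (binom indet (int (p + q))) c = poly (kpoly 0 p * kpoly 0 q + ?S) c"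
      by (simp add: weighted_sum_def sum_distrib_left)
  qed
  show ?thesis
  proof (rule conjI[OF 1 arg_cong2[where f = "(+)"]], goal_cases)
    case 1
    show ?case by (simp add: kpoly_def)
  next
    case 2
    show ?case
    proof (rule sum.cong[OF refl], rule poly_eq_by_evaluation, goal_cases)
      case (1 i c)
      hence "i \<ge> 1" by simp
      thus ?case by (simp only: poly_lam_kpoly poly_explicit_summand)
    qed
  qed
qed

end
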